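(* Let $1<p\le 2$ and $\alpha\in(-1-p,\,-1-\frac p2]$. Assume that there exists a sequence of linear combinations $S_N=\mathbf 1+\sum_{k=2}^N c_{k,N}\,r_k$, $N\ge 1$ (with scalar coefficients $c_{k,N}$), such that $\|S_N\|_{p,\alpha}\to 0$ as $N\to\infty$. Then the Riemann zeta function $\zeta$ has no zeros in the half-plane $\{s\in\mathbb C:\ \Re(s)>-\frac{\alpha+1}{p}\}$. Moreover, if the same assumption holds for $p=1$ and some $\alpha\in[-2,-3/2]$ (that is, there exist such $S_N$ with $\|S_N\|_{1,\alpha}\to0$), then $\zeta$ has no zeros in the closed half-plane $\{s\in\mathbb C:\ \Re(s)\ge-(\alpha+1)\}$.
   Context: $\mathbb N=\{1,2,3,\dots\}$. $\{x\}$ denotes the fractional part of a real number $x$. For $k\ge2$, $r_k$ is the sequence $r_k(n)=k\left\{\frac nk\right\}$, $n\in\mathbb N$, and $\mathbf 1$ is the constant sequence $\mathbf 1(n)=1$ for all $n\in\mathbb N$. For $1\le p\le2$, $\alpha\in\mathbb R$ and a complex sequence $u=\{u(n)\}_{n\ge1}$, $$\|u\|_{p,\alpha}=\Big(\sum_{n=1}^\infty |u(n)|^p\,n^{\alpha}\Big)^{1/p};$$ equivalently, this is the norm of $g(z)=\sum_{n\ge1}u(n)z^{n-1}$ in the space $X^p_\alpha$ of holomorphic functions $\sum_{k\ge0}a_kz^k$ on the unit disc with norm $(\sum_{k\ge0}|a_k|^p(k+1)^\alpha)^{1/p}<\infty$. $\zeta$ is the Riemann zeta function, analytically continued to $\mathbb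 C\setminus\{1\}$; "no zeros" in a region refers to points $s\ne1$ of that region. *)

theory Defs
  imports "HOL-Complex_Analysis.Complex_Analysis"
begin

text \<open>
  The Riemann zeta function is the unique holomorphic function on the plane without \<open>1\<close> that
  extends its Dirichlet series.  The value at the pole \<open>1\<close> is pinned to \<open>0\<close> by convention,
  only in order to make the function unique on the whole type.
\<close>

definition zeta :: "complex \<Rightarrow> complex" where
  "zeta = (THE f. f holomorphic_on (- {1}) \<and>
                  (\<forall>s. Re s > 1 \<longrightarrow> (\<lambda>n. 1 / of_nat (Suc n) powr s) sums f s) \<and>
                  f 1 = 0)"

text \<open>
  Sequences indexed by the positive integers are functions on \<open>nat\<close> whose value at \<open>0\<close> is
  never used: the norm runs over the arguments \<open>Suc n\<close>.
\<close>

definition r :: "nat \<Rightarrow> nat \<Rightarrow> real" where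
  "r k n = real k * frac (real n / real k)"

definition S :: "(nat \<Rightarrow> nat \<Rightarrow> complex) \<Rightarrow> nat \<Rightarrow> nat \<Rightarrow> complex" where
  "S c N n = 1 + (\<Sum>k=2..N. c k N * complex_of_real (r k n))"

definition wnorm :: "real \<Rightarrow> real \<Rightarrow> (nat \<Rightarrow> complex) \<Rightarrow> real" where
  "wnorm p \<alpha> u = (\<Sum>n. cmod (u (Suc n)) powr p * real (Suc n) powr \<alpha>) powr (1 / p)"

text \<open>
  The series defining the norm of \<open>S c N\<close> converges in the range of parameters considered,
  so the real-valued \<open>suminf\<close> above is the genuine sum.
\<close>

lemma summable_S:
  assumes "p > 0" "\<alpha> < -1"
  shows "summable (\<lambda>n. cmod (S c N (Suc n)) powr p * real (Suc n) powr \<alpha>)"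
proof (rule summable_comparison_test')
  define B where "B = 1 + (\<Sum>k=2..N. cmod (c k N) * real k)"
  have bound: "cmod (S c N n) \<le> B" for n
  proof -
    have "cmod (S c N n) \<le> 1 + (\<Sum>k=2..N. cmod (c k N * complex_of_real (r k n)))"
      unfolding S_def by (rule order_trans[OF norm_triangle_ineq]) (simp add: norm_sum)
    also have "\<dots> \<le> B"
      unfolding B_def
    proof (intro add_left_mono sum_mono)
      fix k
      have "\<bar>r k n\<bar> \<le> real k"
        using frac_lt_1[of "real n / real k"]
        by (simp add: r_def abs_mult mult_left_le)
      then show "cmod (c k N * complex_of_real (r k n)) \<le> cmod (c k N) * real k"
        by (simp add: norm_mult mult_left_mono)
    qed
    finally show ?thesis .
  qed
  have "summable (\<lambda>n. real n powr \<alpha>)"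
    using assms by (simp add: summable_real_powr_iff)
  then have "summable (\<lambda>n. real (Suc n) powr \<alpha>)"
    by (subst summable_Suc_iff)
  then show "summable (\<lambda>n. B powr p * real (Suc n) powr \<alpha>)"
    by (rule summable_mult)
  show "norm (cmod (S c N (Suc n)) powr p * real (Suc n) powr \<alpha>)
          \<le> B powr p * real (Suc n) powr \<alpha>" if "n \<ge> 0" for n
    using bound[of "Suc n"] assms by (simp add: abs_mult mult_right_mono powr_mono2)
qed

end

theory Submission
  imports Defs
begin

text \<open>
  The proof is by duality.  For \<open>Re s > 0\<close> put \<open>h n = n powr (- s) - (n + 1) powr (- s)\<close> and consider
  the linear functional that sends a sequence \<open>u\<close> to the sum of \<open>u n * h n\<close> over \<open>n \<ge> 1\<close>.
  Telescoping shows that it sends the constant sequence to \<open>1\<close>.  On \<open>r k\<close>, which grows by \<open>1\<close> at each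
  step except that it falls back to \<open>0\<close> at the multiples of \<open>k\<close>, summation by parts gives
  \<open>(1 - k powr (1 - s)) * zeta s\<close>, at first for \<open>Re s > 1\<close> and then for \<open>Re s > 0\<close>, \<open>s \<noteq> 1\<close>, by analytic
  continuation (\<open>r_fdiff_sums\<close>).  Hence if \<open>zeta s = 0\<close>, the functional is \<open>1\<close> on every \<open>S c N\<close>
  (\<open>S_fdiff_sums\<close>).

  On the other hand \<open>h n = O(n powr (- Re s - 1))\<close>, so that \<open>h\<close> lies in the dual of the weighted
  \<open>p\<close>-summable sequences as soon as \<open>Re s > - (\<alpha> + 1) / p\<close>; for \<open>p = 1\<close> the dual norm is a supremum,
  and equality is good enough.  A bounded functional cannot be constantly \<open>1\<close> along a sequence that
  tends to \<open>0\<close>, so \<open>zeta s \<noteq> 0\<close>.  The argument is uniform in the whole range of \<open>s\<close>, including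
  \<open>Re s \<ge> 1\<close>.

  Since \<^term>\<open>zeta\<close> is given by a definite description, using it requires that the continuation to the
  plane without \<open>1\<close> exists.  Two partial continuations are glued.  Subtracting from each \<open>n powr (- s)\<close>
  the integral of \<open>x powr (- s)\<close> over \<open>{n..n + 1}\<close>, and restoring the total \<open>1 / (s - 1)\<close> of these
  integrals, continues the series to \<open>Re s > 0\<close> (\<open>zeta_strip\<close>).  Euler's transformation of the alternating series continues
  \<open>(1 - 2 powr (1 - s)) * zeta s\<close> to an entire function (\<open>eta\<close>), and the factor in front has no zero
  with \<open>Re s < 1\<close>.
\<close>

section \<open>Iterated differences of complex powers\<close>

text \<open>
  Up to the sign \<open>(-1) ^ m\<close>, this is the \<open>m\<close>-th forward difference in \<open>x\<close> of \<open>x powr (- s)\<close>.  With this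
  sign, \<open>m = 0\<close> gives the terms of the Dirichlet series and \<open>m = 1\<close> the weights \<open>h\<close> of the functional.
\<close>

fun fdiff :: "nat \<Rightarrow> complex \<Rightarrow> real \<Rightarrow> complex" where
  "fdiff 0 s x = complex_of_real x powr (- s)"
| "fdiff (Suc m) s x = fdiff m s x - fdiff m s (x + 1)"

lemma fdiff_has_vector_derivative:
  assumes "x > 0"
  shows "(fdiff m s has_vector_derivative - s * fdiff m (s + 1) x) (at x)"
  using assms
proof (induction m arbitrary: x)
  case 0
  have "((\<lambda>z. z powr (- s)) has_field_derivative - s * complex_of_real x powr (- s - 1)) (at (complex_of_real x))"
    using 0 by (intro has_field_derivative_powr) auto
  from has_vector_derivative_real_field[OF this]
  show ?case by (simp add: fun_eq_iff)
next
  case (Suc m)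
  have "(fdiff m s has_vector_derivative - s * fdiff m (s + 1) (x + 1)) (at (x + 1))"
    using Suc by simp
  then have "((\<lambda>y. fdiff m s (y + 1)) has_vector_derivative - s * fdiff m (s + 1) (x + 1)) (at x)"
    using vector_diff_chain_at[of "\<lambda>y. y + 1" 1 x "fdiff m s" "- s * fdiff m (s + 1) (x + 1)"]
    by (simp add: o_def has_vector_derivative_add_const)
  from has_vector_derivative_diff[OF Suc.IH[OF Suc.prems] this]
  show ?case by (simp add: algebra_simps)
qed

lemma norm_fdiff_diff_le:
  assumes "0 < x" "x \<le> z" and B: "\<And>y. y \<in> {x..z} \<Longrightarrow> norm (fdiff m (s + 1) y) \<le> B"
  shows "norm (fdiff m s z - fdiff m s x) \<le> norm s * B * (z - x)"
proof -
  have "norm (fdiff m s z - fdiff m s x) \<le> (norm s * B) * norm (z - x)"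
  proof (rule differentiable_bound)
    show "convex {x..z}" "z \<in> {x..z}" "x \<in> {x..z}" using assms by auto
    fix y assume y: "y \<in> {x..z}"
    show "(fdiff m s has_derivative (\<lambda>h. h *\<^sub>R (- s * fdiff m (s + 1) y))) (at y within {x..z})"
      using fdiff_has_vector_derivative[of y m s] y assms(1)
      by (simp add: has_vector_derivative_def has_derivative_at_withinI)
    have "norm (- s * fdiff m (s + 1) y) \<le> norm s * B"
      using B[OF y] by (simp add: norm_mult mult_left_mono)
    then show "onorm (\<lambda>h. h *\<^sub>R (- s * fdiff m (s + 1) y)) \<le> norm s * B"
      by (intro onorm_le) (metis abs_ge_zero mult.commute mult_left_mono norm_scaleR real_norm_def)
  qed
  then show ?thesis using assms(2) by simp
qed

text \<open>
  Each difference gains one power of \<open>x\<close>, because by the mean value inequality it costs one derivative,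
  and the derivative replaces \<open>s\<close> by \<open>s + 1\<close>.  The sign condition makes the bound nonincreasing in \<open>x\<close>,
  so that its maximum over \<open>{x..x + 1}\<close> is at the left end.
\<close>

lemma norm_fdiff_le:
  assumes "Re s + real m \<ge> 0" "x > 0"
  shows "norm (fdiff m s x) \<le> (norm s + real m) ^ m * x powr (- Re s - real m)"
  using assms
proof (induction m arbitrary: s x)
  case 0
  then show ?case by (simp add: norm_powr_real_powr)
next
  case (Suc m)
  define B where "B = (norm s + real (Suc m)) ^ m * x powr (- Re s - real (Suc m))"
  have "norm (fdiff m (s + 1) y) \<le> B" if y: "y \<in> {x..x + 1}" for y
  proof -
    have "norm (fdiff m (s + 1) y) \<le> (norm (s + 1) + real m) ^ m * y powr (- Re (s + 1) - real m)"
      using Suc.prems y by (intro Suc.IH) auto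
    also have "\<dots> \<le> B"
      unfolding B_def
    proof (intro mult_mono power_mono)
      show "norm (s + 1) + real m \<le> norm s + real (Suc m)"
        using norm_triangle_ineq[of s 1] by simp
      have e: "- Re (s + 1) - real m = - Re s - real (Suc m)" by simp
      show "y powr (- Re (s + 1) - real m) \<le> x powr (- Re s - real (Suc m))"
        unfolding e using y Suc.prems by (intro powr_mono2') auto
    qed auto
    finally show ?thesis .
  qed
  then have "norm (fdiff m s (x + 1) - fdiff m s x) \<le> norm s * B * (x + 1 - x)"
    using Suc.prems by (intro norm_fdiff_diff_le) auto
  also have "\<dots> \<le> (norm s + real (Suc m)) * B"
    by (simp add: B_def mult_right_mono)
  finally show ?case
    by (simp add: B_def norm_minus_commute mult.assoc)
qed

lemma norm_fdiff_1_le: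
  assumes "Re s > 0" "x > 0"
  shows "norm (fdiff 1 s x) \<le> (norm s + 1) * x powr (- (Re s + 1))"
  proof -
  have "- (Re s + 1) = - Re s - real 1" by simp
  then show ?thesis
    using norm_fdiff_le[of s 1 x] assms by (simp only: power_one_right of_nat_1)
qed

lemma fdiff_holomorphic: "x > 0 \<Longrightarrow> (\<lambda>s. fdiff m s x) holomorphic_on A"
proof (induction m arbitrary: x)
  case 0
  then show ?case by (auto intro!: holomorphic_intros)
next
  case (Suc m)
  then show ?case by (simp add: holomorphic_on_diff)
qed

lemma summable_Suc_powr:
  assumes "b < - 1"
  shows "summable (\<lambda>n. real (Suc n) powr b)"
proof -
  have "summable (\<lambda>n. real n powr b)"
    using assms by (simp add: summable_real_powr_iff)
  then show ?thesis
    by (subst summable_Suc_iff)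
qed

lemma fdiff_tendsto_0:
  assumes "Re s > 0"
  shows "(\<lambda>n. fdiff 0 s (real (Suc n))) \<longlonglongrightarrow> 0"
proof (rule tendsto_norm_zero_cancel)
  have "(\<lambda>n. real (Suc n) powr (- Re s)) \<longlonglongrightarrow> 0"
    using assms by (intro tendsto_neg_powr filterlim_compose[OF filterlim_real_sequentially filterlim_Suc]) auto
  then show "(\<lambda>n. norm (fdiff 0 s (real (Suc n)))) \<longlonglongrightarrow> 0"
    by (simp add: norm_powr_real_powr del: of_nat_Suc)
qed

lemma fdiff_1_sums:
  assumes "Re s > 0"
  shows "(\<lambda>n. fdiff 1 s (real (Suc n))) sums 1"
proof -
  have "(\<lambda>n. fdiff 0 s (real (Suc n)) - fdiff 0 s (real (Suc (Suc n)))) sums (fdiff 0 s (real (Suc 0)) - 0)"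
    by (rule telescope_sums'[OF fdiff_tendsto_0[OF assms]])
  then show ?thesis
    by (simp add: add_ac)
qed

section \<open>Holomorphic series with a power bound\<close>

text \<open>
  Near each point \<open>z\<close>, continuity lets \<open>K z + 1\<close> and the midpoint of \<open>1\<close> and \<open>\<beta> z\<close> serve as uniform
  constants, so the Weierstrass test applies locally.
\<close>

lemma holomorphic_suminf_powr_bound:
  fixes f :: "nat \<Rightarrow> complex \<Rightarrow> complex" and K \<beta> :: "complex \<Rightarrow> real"
  assumes A: "open A" and f: "\<And>n. f n holomorphic_on A"
    and K: "continuous_on A K" and \<beta>: "continuous_on A \<beta>" "\<And>z. z \<in> A \<Longrightarrow> \<beta> z > 1"
    and bound: "\<And>n z. z \<in> A \<Longrightarrow> norm (f n z) \<le> K z * real (Suc n) powr (- \<beta> z)"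
  shows "\<And>z. z \<in> A \<Longrightarrow> (\<lambda>n. f n z) sums (\<Sum>n. f n z)"
    and "(\<lambda>z. \<Sum>n. f n z) holomorphic_on A"
proof -
  have loc: "\<exists>d h. 0 < d \<and> summable h \<and>
      (\<forall>\<^sub>F n in sequentially. \<forall>w\<in>ball z d \<inter> A. norm (f n w) \<le> h n)" if z: "z \<in> A" for z
  proof -
    define b where "b = (\<beta> z + 1) / 2"
    have b: "b > 1" "b < \<beta> z" using \<beta>(2)[OF z] by (auto simp: b_def)
    have "(K \<longlongrightarrow> K z) (at z)" "(\<beta> \<longlongrightarrow> \<beta> z) (at z)"
      using K \<beta>(1) z A by (metis continuous_on_def at_within_open)+
    then have "\<forall>\<^sub>F w in at z. K w < K z + 1" "\<forall>\<^sub>F w in at z. \<beta> w > b"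
      using b by (auto intro: order_tendstoD)
    then have "\<forall>\<^sub>F w in nhds z. K w < K z + 1 \<and> \<beta> w > b"
      using b by (auto simp: eventually_nhds_conv_at eventually_conj_iff)
    then obtain d where d: "d > 0" "\<And>w. dist w z < d \<Longrightarrow> K w < K z + 1 \<and> \<beta> w > b"
      unfolding eventually_nhds_metric by blast
    have "summable (\<lambda>n. real n powr (- b))"
      using b by (simp add: summable_real_powr_iff)
    then have sum: "summable (\<lambda>n. (K z + 1) * real (Suc n) powr (- b))"
      by (intro summable_mult) (subst summable_Suc_iff)
    have "norm (f n w) \<le> (K z + 1) * real (Suc n) powr (- b)" if w: "w \<in> ball z d \<inter> A" for n w
    proof -
      have Kw: "K w < K z + 1" "\<beta> w > b" using d(2)[of w] w by (auto simp: dist_commute)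
      have "0 \<le> K w * real (Suc n) powr (- \<beta> w)"
        using bound[of w n] w norm_ge_zero order_trans by blast
      then have "K w \<ge> 0"
        by (simp add: zero_le_mult_iff del: of_nat_Suc)
      then show ?thesis
        using bound[of w n] Kw w
        by (intro order_trans[OF bound] mult_mono powr_mono) auto
    qed
    then show ?thesis
      using d(1) sum by (intro exI[of _ d] exI[of _ "\<lambda>n. (K z + 1) * real (Suc n) powr (- b)"]) auto
  qed
  obtain g g' where g: "\<And>z. z \<in> A \<Longrightarrow> (\<lambda>n. f n z) sums g z \<and> (g has_field_derivative g' z) (at z)"
    using series_and_derivative_comparison_local[of A f "\<lambda>n. deriv (f n)", OF A _ loc]
      holomorphic_derivI[OF f A] by blast
  show "(\<lambda>n. f n z) sums (\<Sum>n. f n z)" if "z \<in> A" for z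
    using g that by (simp add: sums_iff)
  have "g holomorphic_on A"
    using g A by (auto simp: holomorphic_on_open)
  then show "(\<lambda>z. \<Sum>n. f n z) holomorphic_on A"
    using g by (subst holomorphic_cong[of A A _ g]) (auto simp: sums_iff)
qed


section \<open>The alternating zeta function\<close>

definition eta_tail :: "nat \<Rightarrow> complex \<Rightarrow> complex" where
  "eta_tail m s = (\<Sum>n. (-1) ^ n * fdiff m s (real (Suc n)))"

lemma
  shows eta_tail_sums:
      "Re s > 1 - real m \<Longrightarrow> (\<lambda>n. (-1) ^ n * fdiff m s (real (Suc n))) sums eta_tail m s"
    and eta_tail_holomorphic: "eta_tail m holomorphic_on {s. Re s > 1 - real m}"
proof -
  let ?A = "{s. Re s > 1 - real m}"
  have bound: "norm ((-1) ^ n * fdiff m s (real (Suc n)))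
      \<le> (norm s + real m) ^ m * real (Suc n) powr (- (Re s + real m))" if "s \<in> ?A" for n s
    using norm_fdiff_le[of s m "real (Suc n)"] that by (simp add: norm_mult norm_power algebra_simps)
  note * = holomorphic_suminf_powr_bound[of ?A "\<lambda>n s. (-1) ^ n * fdiff m s (real (Suc n))"
      "\<lambda>s. (norm s + real m) ^ m" "\<lambda>s. Re s + real m", OF open_halfspace_Re_gt _ _ _ _ bound]
  show "Re s > 1 - real m \<Longrightarrow> (\<lambda>n. (-1) ^ n * fdiff m s (real (Suc n))) sums eta_tail m s"
    unfolding eta_tail_def
    by (rule *(1)) (auto intro!: continuous_intros holomorphic_intros fdiff_holomorphic simp del: of_nat_Suc)
  have "(\<lambda>s. eta_tail m s) holomorphic_on ?A"
    unfolding eta_tail_def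
    by (rule *(2)) (auto intro!: continuous_intros holomorphic_intros fdiff_holomorphic simp del: of_nat_Suc)
  then show "eta_tail m holomorphic_on ?A" by simp
qed

text \<open>
  One step of Euler's transformation: the alternating sum of differences is twice the alternating sum
  minus the initial term.  The right-hand side makes sense on a half-plane that is wider by \<open>1\<close>.
\<close>

lemma eta_tail_Suc:
  assumes "Re s > 1 - real m"
  shows "eta_tail m s = fdiff m s 1 / 2 + eta_tail (Suc m) s / 2"
proof -
  let ?a = "\<lambda>n. fdiff m s (real (Suc n))"
  have 1: "(\<lambda>n. (-1) ^ n * ?a n) sums eta_tail m s"
    by (rule eta_tail_sums[OF assms])
  then have "(\<lambda>n. (-1) ^ Suc n * ?a (Suc n)) sums (eta_tail m s - ?a 0)"
    by (subst sums_Suc_iff) simp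
  from sums_add[OF 1 this]
  have "(\<lambda>n. (-1) ^ n * fdiff (Suc m) s (real (Suc n))) sums (eta_tail m s + (eta_tail m s - ?a 0))"
    by (simp add: algebra_simps)
  moreover have "(\<lambda>n. (-1) ^ n * fdiff (Suc m) s (real (Suc n))) sums eta_tail (Suc m) s"
    using assms by (intro eta_tail_sums) auto
  ultimately have "eta_tail (Suc m) s = eta_tail m s + (eta_tail m s - ?a 0)"
    using sums_unique2 by blast
  then show ?thesis by (simp add: field_simps)
qed

text \<open>The outcome of \<open>m\<close> steps of Euler's transformation, valid for \<open>Re s > 1 - real m\<close>.\<close>

definition eta_euler :: "nat \<Rightarrow> complex \<Rightarrow> complex" where
  "eta_euler m s = (\<Sum>j<m. fdiff j s 1 / 2 ^ Suc j) + eta_tail m s / 2 ^ m"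

text \<open>
  The number of steps depends on \<open>s\<close>; any number that is large enough for \<open>s\<close> gives the same value
  (\<open>eta_eq_eta_euler\<close>).
\<close>

definition eta :: "complex \<Rightarrow> complex" where
  "eta s = eta_euler (nat \<lceil>2 - Re s\<rceil>) s"

lemma eta_euler_eq:
  assumes "Re s > 1 - real m" "m \<le> m'"
  shows "eta_euler m' s = eta_euler m s"
  using assms(2)
proof (induction m' rule: dec_induct)
  case (step k)
  then have "eta_tail k s = fdiff k s 1 / 2 + eta_tail (Suc k) s / 2"
    using assms by (intro eta_tail_Suc) auto
  then have "eta_euler (Suc k) s = eta_euler k s"
    by (simp add: eta_euler_def add_divide_distrib)
  then show ?case using step.IH by simp
qed simp

lemma eta_eq_eta_euler:
  assumes "Re s > 1 - real m"
  shows "eta s = eta_euler m s"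
proof -
  define k where "k = nat \<lceil>2 - Re s\<rceil>"
  have "Re s > 1 - real k" unfolding k_def by linarith
  then have "eta_euler (max k m) s = eta_euler k s" "eta_euler (max k m) s = eta_euler m s"
    using assms by (auto intro!: eta_euler_eq)
  then show ?thesis by (simp add: eta_def k_def)
qed

lemma eta_holomorphic: "eta holomorphic_on A"
proof -
  have "eta holomorphic_on (\<Union>m. {s. Re s > 1 - real m})"
  proof (rule holomorphic_on_UN_open)
    fix m :: nat
    have "eta_euler m holomorphic_on {s. Re s > 1 - real m}"
      unfolding eta_euler_def[abs_def]
      by (intro holomorphic_intros fdiff_holomorphic eta_tail_holomorphic) auto
    then show "eta holomorphic_on {s. Re s > 1 - real m}"
      by (rule holomorphic_transform) (simp add: eta_eq_eta_euler)
  qed (rule open_halfspace_Re_gt)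
  moreover have "\<exists>m. Re s > 1 - real m" for s
    using reals_Archimedean2[of "1 - Re s"] by (auto simp: algebra_simps)
  then have "(\<Union>m. {s. Re s > 1 - real m}) = UNIV"
    by auto
  ultimately show ?thesis
    by (metis holomorphic_on_subset subset_UNIV)
qed


section \<open>Continuation of the Riemann zeta function\<close>

text \<open>
  The quotient \<open>fdiff 1 (s - 1) x / (s - 1)\<close> is the integral of \<open>t powr (- s)\<close> over \<open>{x..x + 1}\<close>.
  These integrals add up to the term \<open>1 / (s - 1)\<close> in front when \<open>Re s > 1\<close>.
\<close>

definition zeta_strip :: "complex \<Rightarrow> complex" where
  "zeta_strip s = 1 / (s - 1) +
     (\<Sum>n. fdiff 0 s (real (Suc n)) - fdiff 1 (s - 1) (real (Suc n)) / (s - 1))"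

text \<open>
  The difference between \<open>t powr (- s)\<close> at one point and its mean over a unit interval is controlled by
  the derivative, which gains the factor \<open>1 / x\<close> needed for convergence in \<open>Re s > 0\<close>.
\<close>

lemma norm_fdiff_minus_integral_le:
  assumes "Re s > 0" "s \<noteq> 1" "x > 0"
  shows "norm (fdiff 0 s x - fdiff 1 (s - 1) x / (s - 1)) \<le> norm s * x powr (- (Re s + 1))"
proof -
  define B where "B = norm s * x powr (- (Re s + 1))"
  let ?\<phi>' = "\<lambda>y. - (s - 1) * fdiff 0 s y"
  have "norm (fdiff 0 (s - 1) (x + 1) - fdiff 0 (s - 1) x - (x + 1 - x) *\<^sub>R ?\<phi>' x)
      \<le> norm (x + 1 - x) * (norm (s - 1) * B)"
  proof (rule vector_differentiable_bound_linearization[where S = "{x..x + 1}"])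
    fix y assume y: "y \<in> {x..x + 1}"
    show "(fdiff 0 (s - 1) has_vector_derivative ?\<phi>' y) (at y within {x..x + 1})"
      using fdiff_has_vector_derivative[of y 0 "s - 1"] y assms
      by (auto intro!: has_vector_derivative_at_within simp del: fdiff.simps)
    have "norm (fdiff 0 s y - fdiff 0 s x) \<le> norm s * x powr (- (Re s + 1)) * (y - x)"
    proof (rule norm_fdiff_diff_le)
      fix t assume "t \<in> {x..y}"
      moreover from this have "t powr (- (Re s + 1)) \<le> x powr (- (Re s + 1))"
        using assms by (intro powr_mono2') auto
      ultimately show "norm (fdiff 0 (s + 1) t) \<le> x powr (- (Re s + 1))"
        using norm_fdiff_le[of "s + 1" 0 t] assms by simp
    qed (use y assms in auto)
    also have "\<dots> \<le> B"
      using y by (auto simp: B_def intro!: mult_left_le)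
    finally have "norm (s - 1) * norm (fdiff 0 s y - fdiff 0 s x) \<le> norm (s - 1) * B"
      by (rule mult_left_mono) simp
    moreover have "?\<phi>' y - ?\<phi>' x = - ((s - 1) * (fdiff 0 s y - fdiff 0 s x))"
      by (simp add: algebra_simps)
    ultimately show "norm (?\<phi>' y - ?\<phi>' x) \<le> norm (s - 1) * B"
      by (metis norm_minus_cancel norm_mult)
  qed (auto simp: closed_segment_eq_real_ivl)
  also have "fdiff 0 (s - 1) (x + 1) - fdiff 0 (s - 1) x - (x + 1 - x) *\<^sub>R ?\<phi>' x
      = (s - 1) * (fdiff 0 s x - fdiff 1 (s - 1) x / (s - 1))"
    using assms by (simp add: field_simps)
  finally show ?thesis
    using assms by (simp add: norm_mult B_def)
qed

lemma
  shows zeta_strip_holomorphic: "zeta_strip holomorphic_on {s. Re s > 0} - {1}"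
    and zeta_strip_sums: "Re s > 1 \<Longrightarrow> (\<lambda>n. fdiff 0 s (real (Suc n))) sums zeta_strip s"
proof -
  let ?A = "{s. Re s > 0} - {1}"
  let ?f = "\<lambda>n s. fdiff 0 s (real (Suc n)) - fdiff 1 (s - 1) (real (Suc n)) / (s - 1)"
  have A: "open ?A" by (intro open_delete open_halfspace_Re_gt)
  have bound: "norm (?f n s) \<le> norm s * real (Suc n) powr (- (Re s + 1))" if "s \<in> ?A" for n s
    using that by (intro norm_fdiff_minus_integral_le) auto
  have hol: "?f n holomorphic_on ?A" for n
  proof -
    have "(\<lambda>s. fdiff 1 s (real (Suc n))) \<circ> (\<lambda>s. s - 1) holomorphic_on ?A"
      by (rule holomorphic_on_compose) (auto intro!: holomorphic_intros fdiff_holomorphic simp del: fdiff.simps)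
    then show ?thesis
      by (intro holomorphic_intros fdiff_holomorphic) (auto simp: o_def)
  qed
  note * = holomorphic_suminf_powr_bound[of ?A ?f "\<lambda>s. norm s" "\<lambda>s. Re s + 1", OF A hol _ _ _ bound]
  have "(\<lambda>s. \<Sum>n. ?f n s) holomorphic_on ?A"
    by (rule *(2)) (auto intro!: continuous_intros)
  then show "zeta_strip holomorphic_on ?A"
    unfolding zeta_strip_def[abs_def] by (intro holomorphic_intros) auto
  assume s: "Re s > 1"
  have "(\<lambda>n. ?f n s) sums (\<Sum>n. ?f n s)"
    by (rule *(1)) (use s in \<open>auto intro!: continuous_intros\<close>)
  moreover have "(\<lambda>n. fdiff 1 (s - 1) (real (Suc n)) / (s - 1)) sums (1 / (s - 1))"
    using s by (intro sums_divide fdiff_1_sums) auto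
  ultimately have "(\<lambda>n. ?f n s + fdiff 1 (s - 1) (real (Suc n)) / (s - 1)) sums
      ((\<Sum>n. ?f n s) + 1 / (s - 1))"
    by (rule sums_add)
  then show "(\<lambda>n. fdiff 0 s (real (Suc n))) sums zeta_strip s"
    by (simp add: zeta_strip_def add.commute del: fdiff.simps)
qed

text \<open>
  The terms of the Dirichlet series at the multiples of \<open>k\<close> add up to \<open>k powr (- s) * Z\<close>.  For \<open>k = 2\<close> the
  coefficients on the left are the alternating signs, and for general \<open>k\<close> they are the increments of \<open>r k\<close>.
\<close>

lemma sums_reweight_multiples:
  assumes Z: "(\<lambda>n. fdiff 0 s (real (Suc n))) sums Z" and k: "k > 0"
  shows "(\<lambda>n. (1 - (if k dvd Suc n then of_nat k else 0)) * fdiff 0 s (real (Suc n)))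
           sums ((1 - of_nat k powr (1 - s)) * Z)"
proof -
  define f where "f n = (if k dvd Suc n then of_nat k * fdiff 0 s (real (Suc n)) else 0)" for n
  define g where "g m = k * Suc m - 1" for m
  have Suc_g: "Suc (g m) = k * Suc m" for m
    using k by (simp add: g_def)
  have "strict_mono g"
    unfolding strict_mono_Suc_iff
  proof
    fix m
    have "Suc (g m) < Suc (g (Suc m))" unfolding Suc_g using k by simp
    then show "g m < g (Suc m)" by simp
  qed
  moreover have "f n = 0" if "n \<notin> range g" for n
  proof (rule ccontr)
    assume "f n \<noteq> 0"
    then obtain j where j: "Suc n = k * j" by (auto simp: f_def split: if_splits)
    then obtain m where "j = Suc m" by (cases j) auto
    with j have "n = g m" by (simp add: g_def)
    with that show False by blast
  qed
  ultimately have reindex: "(\<lambda>m. f (g m)) sums c \<longleftrightarrow> f sums c" for c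
    by (rule sums_mono_reindex)
  have "f (g m) = of_nat k powr (1 - s) * fdiff 0 s (real (Suc m))" for m
  proof -
    have "complex_of_real (real (Suc (g m))) powr (- s)
        = of_nat k powr (- s) * complex_of_real (real (Suc m)) powr (- s)"
      unfolding Suc_g of_nat_mult of_real_mult
      by (subst powr_times_real) auto
    moreover have "of_nat k * of_nat k powr (- s) = (of_nat k :: complex) powr (1 - s)"
      using k by (simp add: powr_diff powr_minus field_simps)
    ultimately show ?thesis
      by (simp add: f_def Suc_g del: of_nat_Suc)
  qed
  then have "f sums (of_nat k powr (1 - s) * Z)"
    using sums_mult[OF Z, of "of_nat k powr (1 - s)"] by (simp add: reindex[symmetric] del: fdiff.simps)
  moreover have "fdiff 0 s (real (Suc n)) - f n
      = (1 - (if k dvd Suc n then of_nat k else 0)) * fdiff 0 s (real (Suc n))" for n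
    by (simp add: f_def algebra_simps)
  ultimately show ?thesis
    using sums_diff[OF Z, of f "of_nat k powr (1 - s) * Z"]
    by (simp add: left_diff_distrib del: fdiff.simps)
qed

lemma half_plane_identity:
  assumes "f holomorphic_on {s. Re s > 0} - {1}" "g holomorphic_on {s. Re s > 0} - {1}"
    and "\<And>s. Re s > 1 \<Longrightarrow> f s = g s" and "Re s > 0" "s \<noteq> 1"
  shows "f s = g s"
proof (rule analytic_continuation_open[of "{s. Re s > 1}" "{s. Re s > 0} - {1}" f g])
  show "connected ({s. Re s > 0} - {1})"
    by (intro connected_open_delete open_halfspace_Re_gt convex_connected convex_halfspace_Re_gt) simp
  have "(2::complex) \<in> {s. Re s > 1}" by simp
  then show "{s::complex. Re s > 1} \<noteq> {}" by blast
qed (use assms in \<open>auto intro!: open_delete open_halfspace_Re_gt\<close>)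

lemma one_minus_2_powr_times_zeta_strip:
  assumes "Re s > 0" "s \<noteq> 1"
  shows "(1 - 2 powr (1 - s)) * zeta_strip s = eta s"
proof (rule half_plane_identity[OF _ eta_holomorphic _ assms])
  show "(\<lambda>s. (1 - 2 powr (1 - s)) * zeta_strip s) holomorphic_on {s. Re s > 0} - {1}"
    by (intro holomorphic_intros zeta_strip_holomorphic) auto
  fix s :: complex assume s: "Re s > 1"
  have sgn: "1 - (if 2 dvd Suc n then of_nat 2 else 0) = (-1 :: complex) ^ n" for n
    by (cases "even n") auto
  have "(\<lambda>n. (-1) ^ n * fdiff 0 s (real (Suc n))) sums ((1 - 2 powr (1 - s)) * zeta_strip s)"
    using sums_reweight_multiples[OF zeta_strip_sums[OF s], of 2] unfolding sgn by simp
  moreover have "(\<lambda>n. (-1) ^ n * fdiff 0 s (real (Suc n))) sums eta s"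
    using eta_tail_sums[of 0 s] eta_eq_eta_euler[of 0 s] s by (simp add: eta_euler_def)
  ultimately show "(1 - 2 powr (1 - s)) * zeta_strip s = eta s"
    by (rule sums_unique2)
qed

text \<open>
  Left of the line \<open>Re s = 1\<close> the factor \<open>1 - 2 powr (1 - s)\<close> has no zeros, so \<open>eta\<close> can be divided by it.
  Its zeros on the line, other than \<open>1\<close>, are covered by \<open>zeta_strip\<close>.
\<close>

lemma ex_zeta:
  "\<exists>f. f holomorphic_on - {1} \<and> (\<forall>s. Re s > 1 \<longrightarrow> (\<lambda>n. fdiff 0 s (real (Suc n))) sums f s) \<and> f 1 = 0"
proof -
  let ?A = "{s. Re s > 0} - {1 :: complex}" and ?B = "{s :: complex. Re s < 1}"
  define f where "f s = (if s \<in> ?A then zeta_strip s else eta s / (1 - 2 powr (1 - s)))" for s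
  have nz: "1 - 2 powr (1 - s) \<noteq> 0" if "s \<in> ?B" for s :: complex
  proof -
    have "norm (2 powr (1 - s) :: complex) = 2 powr (1 - Re s)"
      by (simp add: norm_powr_real_powr)
    also have "\<dots> > 1" using that by simp
    finally show ?thesis by auto
  qed
  have "f holomorphic_on ?A \<union> ?B"
    unfolding f_def[abs_def]
  proof (rule holomorphic_on_If_Un)
    show "(\<lambda>s. eta s / (1 - 2 powr (1 - s))) holomorphic_on ?B"
      using nz by (intro holomorphic_intros eta_holomorphic) auto
    fix s assume "s \<in> ?A" "s \<in> ?B"
    then show "zeta_strip s = eta s / (1 - 2 powr (1 - s))"
      using one_minus_2_powr_times_zeta_strip[of s] nz[of s] by (auto simp: field_simps)
  qed (auto intro!: zeta_strip_holomorphic open_delete open_halfspace_Re_gt open_halfspace_Re_lt)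
  moreover have "?A \<union> ?B = - {1}"
    by (auto simp: complex_eq_iff)
  ultimately have f: "f holomorphic_on - {1}" by simp
  have "f(1 := 0) holomorphic_on - {1}"
    by (rule holomorphic_transform[OF f]) auto
  moreover have "(\<lambda>n. fdiff 0 s (real (Suc n))) sums (f(1 := 0)) s" if "Re s > 1" for s
    using zeta_strip_sums[OF that] that by (auto simp: f_def)
  ultimately show ?thesis by (intro exI[of _ "f(1 := 0)"]) auto
qed

lemma
  shows zeta_holomorphic: "zeta holomorphic_on - {1}"
    and zeta_sums: "Re s > 1 \<Longrightarrow> (\<lambda>n. fdiff 0 s (real (Suc n))) sums zeta s"
proof -
  let ?P = "\<lambda>f. f holomorphic_on (- {1}) \<and>
                  (\<forall>s. Re s > 1 \<longrightarrow> (\<lambda>n. 1 / of_nat (Suc n) powr s) sums f s) \<and> f 1 = 0"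
  have eq: "1 / of_nat (Suc n) powr s = fdiff 0 s (real (Suc n))" for n s
    by (simp add: powr_minus_divide del: of_nat_Suc)
  have "\<exists>f. ?P f"
    unfolding eq by (rule ex_zeta)
  then obtain f0 where f0: "?P f0" ..
  have unique: "f = g" if "?P f" "?P g" for f g
  proof
    fix s
    show "f s = g s"
    proof (cases "s = 1")
      case False
      have "(2::complex) \<in> {s. Re s > 1}" by simp
      then have ne: "{s::complex. Re s > 1} \<noteq> {}" by blast
      show ?thesis
      proof (rule analytic_continuation_open[of "{s. Re s > 1}" "- {1}" f g])
        show "connected (- {1 :: complex})"
          using connected_open_delete[OF open_UNIV connected_UNIV, of "1::complex"]
          by (simp add: Compl_eq_Diff_UNIV)
        show "f z = g z" if "z \<in> {s. Re s > 1}" for z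
          using \<open>?P f\<close> \<open>?P g\<close> that sums_unique2 by blast
      qed (use ne that False in \<open>auto intro!: open_halfspace_Re_gt\<close>)
    qed (use that in simp)
  qed
  have P: "?P zeta"
    unfolding zeta_def by (rule theI[of ?P, OF f0 unique[OF _ f0]])
  show "zeta holomorphic_on - {1}"
    using P by (rule conjunct1)
  have "\<forall>s. Re s > 1 \<longrightarrow> (\<lambda>n. 1 / of_nat (Suc n) powr s) sums zeta s"
    using P by (elim conjE)
  then show "Re s > 1 \<Longrightarrow> (\<lambda>n. fdiff 0 s (real (Suc n))) sums zeta s"
    unfolding eq by blast
qed

section \<open>The functional on the sequences \<open>r k\<close>\<close>

lemma r_eq_mod:
  assumes "k > 0"
  shows "r k n = real (n mod k)"
proof -
  have "r k n = real n - real k * real (n div k)"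
    using assms by (simp add: r_def frac_def floor_divide_of_nat_eq field_simps)
  also have "\<dots> = real (n mod k)"
    by (metis add_diff_cancel_left' mult_div_mod_eq of_nat_add of_nat_mult)
  finally show ?thesis .
qed

lemma r_Suc:
  assumes "k > 0"
  shows "r k (Suc n) = r k n + 1 - (if k dvd Suc n then real k else 0)"
  using assms by (auto simp: r_eq_mod mod_Suc dvd_eq_mod_eq_0)

lemma r_fdiff_sums:
  assumes k: "k > 0" and s: "Re s > 0" "s \<noteq> 1"
  shows "(\<lambda>n. complex_of_real (r k (Suc n)) * fdiff 1 s (real (Suc n)))
           sums ((1 - of_nat k powr (1 - s)) * zeta s)"
proof -
  let ?f = "\<lambda>n s. complex_of_real (r k (Suc n)) * fdiff 1 s (real (Suc n))"
  let ?A = "{s::complex. Re s > 0}"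
  have bound: "norm (?f n s) \<le> (real k * (norm s + 1)) * real (Suc n) powr (- (Re s + 1))"
    if "s \<in> ?A" for n s
  proof -
    have "norm (?f n s) = r k (Suc n) * norm (fdiff 1 s (real (Suc n)))"
      using k by (simp add: norm_mult r_eq_mod)
    also have "\<dots> \<le> real k * ((norm s + 1) * real (Suc n) powr (- (Re s + 1)))"
    proof (rule mult_mono)
      show "r k (Suc n) \<le> real k"
        using k by (simp add: r_eq_mod less_imp_le)
      show "norm (fdiff 1 s (real (Suc n))) \<le> (norm s + 1) * real (Suc n) powr (- (Re s + 1))"
        using that by (intro norm_fdiff_1_le) auto
    qed auto
    finally show ?thesis by (simp add: mult.assoc)
  qed
  note * = holomorphic_suminf_powr_bound[of ?A ?f "\<lambda>s. real k * (norm s + 1)" "\<lambda>s. Re s + 1",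
      OF open_halfspace_Re_gt _ _ _ _ bound]
  have hol: "(\<lambda>s. \<Sum>n. ?f n s) holomorphic_on ?A"
    by (rule *(2)) (auto intro!: continuous_intros holomorphic_intros fdiff_holomorphic
        simp del: fdiff.simps of_nat_Suc)
  have sums: "(\<lambda>n. ?f n s) sums (\<Sum>n. ?f n s)" if "Re s > 0" for s
    by (rule *(1)) (use that in \<open>auto intro!: continuous_intros holomorphic_intros fdiff_holomorphic
        simp del: fdiff.simps of_nat_Suc\<close>)
  have "(\<Sum>n. ?f n s) = (1 - of_nat k powr (1 - s)) * zeta s"
  proof (rule half_plane_identity[OF _ _ _ s])
    show "(\<lambda>s. \<Sum>n. ?f n s) holomorphic_on ?A - {1}"
      using hol by (rule holomorphic_on_subset) auto
    show "(\<lambda>s. (1 - of_nat k powr (1 - s)) * zeta s) holomorphic_on ?A - {1}"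
      using k by (intro holomorphic_intros holomorphic_on_subset[OF zeta_holomorphic]) auto
    fix s :: complex assume s: "Re s > 1"
    let ?a = "\<lambda>n. fdiff 0 s (real (Suc n))"
    let ?r = "\<lambda>n. complex_of_real (r k n)"
    have r: "?r (Suc n) = ?r n + 1 - (if k dvd Suc n then of_nat k else 0)" for n
      by (subst r_Suc[OF k]) simp
    \<comment> \<open>Summation by parts: the boundary term at infinity vanishes since \<open>r k\<close> is bounded, the one at
       zero since \<open>r k 0 = 0\<close>.\<close>
    have 1: "(\<lambda>n. (?r (Suc n) - ?r n) * ?a n) sums ((1 - of_nat k powr (1 - s)) * zeta s)"
      using sums_reweight_multiples[OF zeta_sums[OF s] k] by (simp add: r del: fdiff.simps)
    have "(\<lambda>n. ?r n * ?a n) \<longlonglongrightarrow> 0"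
    proof (rule tendsto_0_le[where K = "real k"])
      show "?a \<longlonglongrightarrow> 0" using s by (intro fdiff_tendsto_0) auto
      have "\<bar>r k n\<bar> \<le> real k" for n
        using k by (simp add: r_eq_mod less_imp_le)
      then show "\<forall>\<^sub>F n in sequentially. norm (?r n * ?a n) \<le> norm (?a n) * real k"
        by (intro always_eventually allI)
          (simp add: norm_mult mult.commute[of _ "real k"] mult_right_mono del: fdiff.simps of_nat_Suc)
    qed
    from telescope_sums[OF this]
    have "(\<lambda>n. ?r (Suc n) * ?a (Suc n) - ?r n * ?a n) sums 0"
      using k by (simp add: r_eq_mod)
    from sums_diff[OF 1 this]
    have "(\<lambda>n. ?f n s) sums ((1 - of_nat k powr (1 - s)) * zeta s)"
      by (simp add: algebra_simps)
    then show "(\<Sum>n. ?f n s) = (1 - of_nat k powr (1 - s)) * zeta s"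
      by (simp add: sums_iff)
  qed
  with sums[OF s(1)] show ?thesis by simp
qed

lemma S_fdiff_sums:
  assumes "Re s > 0" "s \<noteq> 1" "zeta s = 0"
  shows "(\<lambda>n. S c N (Suc n) * fdiff 1 s (real (Suc n))) sums 1"
proof -
  let ?h = "\<lambda>n. fdiff 1 s (real (Suc n))"
  have "(\<lambda>n. c k N * (complex_of_real (r k (Suc n)) * ?h n)) sums 0" if "k \<in> {2..N}" for k
  proof -
    have "k > 0" using that by simp
    from sums_mult[OF r_fdiff_sums[OF this assms(1,2)], of "c k N"]
    show ?thesis by (simp only: assms(3) mult_zero_right)
  qed
  then have "(\<lambda>n. \<Sum>k=2..N. c k N * (complex_of_real (r k (Suc n)) * ?h n)) sums (\<Sum>k=2..N. 0)"
    by (rule sums_sum)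
  from sums_add[OF fdiff_1_sums[OF assms(1)] this]
  have "(\<lambda>n. ?h n + (\<Sum>k=2..N. c k N * (complex_of_real (r k (Suc n)) * ?h n))) sums 1"
    by (simp only: sum.neutral_const add_0_right)
  moreover have "S c N (Suc n) * ?h n
      = ?h n + (\<Sum>k=2..N. c k N * (complex_of_real (r k (Suc n)) * ?h n))" for n
    by (simp only: S_def distrib_right sum_distrib_right mult.assoc mult_1_left)
  ultimately show ?thesis by (simp only:)
qed

section \<open>Sequences that pair to at least one\<close>

text \<open>
  The parameter \<open>t\<close> weighs the two sums against each other, as \<open>a n * b n = (t * a n) * (b n / t)\<close>.
  Having \<open>t\<close> free makes this as strong as Hoelder's inequality, without a separate treatment of
  sequences of norm zero.
\<close>

lemma suminf_mult_le_young:
  fixes a b :: "nat \<Rightarrow> real"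
  assumes pq: "p > 1" "q > 1" "1 / p + 1 / q = 1" and t: "t > 0"
    and a: "\<And>n. a n \<ge> 0" "summable (\<lambda>n. a n powr p)"
    and b: "\<And>n. b n \<ge> 0" "summable (\<lambda>n. b n powr q)"
  shows "summable (\<lambda>n. a n * b n)"
    and "(\<Sum>n. a n * b n) \<le> t powr p / p * (\<Sum>n. a n powr p) + t powr (- q) / q * (\<Sum>n. b n powr q)"
proof -
  let ?y = "\<lambda>n. t powr p / p * a n powr p + t powr (- q) / q * b n powr q"
  have le: "a n * b n \<le> ?y n" for n
  proof -
    have "(t * a n) * (b n / t) \<le> (t * a n) powr p / p + (b n / t) powr q / q"
      by (rule Youngs_inequality[OF pq]) (simp_all add: a(1) b(1) t less_imp_le)
    moreover have "(t * a n) powr p / p = t powr p / p * a n powr p"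
      using a(1)[of n] t by (simp add: powr_mult)
    moreover have "(b n / t) powr q / q = t powr (- q) / q * b n powr q"
      using b(1)[of n] t by (simp add: powr_divide powr_minus_divide)
    ultimately show ?thesis using t by simp
  qed
  have y: "?y sums (t powr p / p * (\<Sum>n. a n powr p) + t powr (- q) / q * (\<Sum>n. b n powr q))"
    by (intro sums_add sums_mult summable_sums a(2) b(2))
  show sum: "summable (\<lambda>n. a n * b n)"
    by (rule summable_comparison_test'[OF sums_summable[OF y], of 0]) (simp only: real_norm_def abs_of_nonneg[OF mult_nonneg_nonneg[OF a(1) b(1)]] le)
  show "(\<Sum>n. a n * b n) \<le> t powr p / p * (\<Sum>n. a n powr p) + t powr (- q) / q * (\<Sum>n. b n powr q)"
    using sums_le[OF le summable_sums[OF sum] y] .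
qed

text \<open>
  Otherwise, letting \<open>N\<close> tend to infinity in Young's inequality leaves \<open>1 \<le> t powr (- q) / q * B\<close> for each
  \<open>t > 0\<close>, which fails for large \<open>t\<close>.
\<close>

lemma not_tendsto_0_if_pairing_ge_1:
  fixes a :: "nat \<Rightarrow> nat \<Rightarrow> real" and b :: "nat \<Rightarrow> real"
  assumes pq: "p > 1" "q > 1" "1 / p + 1 / q = 1"
    and a: "\<And>N n. a N n \<ge> 0" "\<And>N. summable (\<lambda>n. a N n powr p)"
    and b: "\<And>n. b n \<ge> 0" "summable (\<lambda>n. b n powr q)"
    and pairing: "\<And>N. (\<Sum>n. a N n * b n) \<ge> 1"
  shows "\<not> (\<lambda>N. \<Sum>n. a N n powr p) \<longlonglongrightarrow> 0"
proof
  assume lim: "(\<lambda>N. \<Sum>n. a N n powr p) \<longlonglongrightarrow> 0"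
  define B where "B = (\<Sum>n. b n powr q)"
  have "1 \<le> t powr (- q) / q * B" if t: "t > 0" for t :: real
  proof (rule LIMSEQ_le_const)
    show "(\<lambda>N. t powr p / p * (\<Sum>n. a N n powr p) + t powr (- q) / q * B) \<longlonglongrightarrow> t powr (- q) / q * B"
      using tendsto_add[OF tendsto_mult[OF tendsto_const[of "t powr p / p"] lim]
          tendsto_const[of "t powr (- q) / q * B"]] by simp
    show "\<exists>M. \<forall>N\<ge>M. 1 \<le> t powr p / p * (\<Sum>n. a N n powr p) + t powr (- q) / q * B"
      using suminf_mult_le_young(2)[OF pq t a(1) a(2) b] pairing unfolding B_def
      by (meson order_trans)
  qed
  then have "\<forall>\<^sub>F t in at_top. 1 \<le> t powr (- q) / q * B"
    by (rule eventually_mono[OF eventually_gt_at_top])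
  moreover have "((\<lambda>t. t powr (- q) / q * B) \<longlongrightarrow> 0 / q * B) at_top"
    using pq(2) by (intro tendsto_intros tendsto_neg_powr filterlim_ident) auto
  ultimately have "1 \<le> 0 / q * B"
    by (intro tendsto_lowerbound) auto
  then show False by simp
qed

section \<open>Approximation excludes zeros\<close>

lemma one_le_suminf_S:
  assumes "Re s > 0" "s \<noteq> 1" "zeta s = 0"
    and "summable (\<lambda>n. norm (S c N (Suc n)) * norm (fdiff 1 s (real (Suc n))))"
  shows "1 \<le> (\<Sum>n. norm (S c N (Suc n)) * norm (fdiff 1 s (real (Suc n))))"
proof -
  let ?f = "\<lambda>n. S c N (Suc n) * fdiff 1 s (real (Suc n))"
  have "norm (\<Sum>n. ?f n) \<le> (\<Sum>n. norm (?f n))"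
    by (rule summable_norm) (simp only: norm_mult assms(4))
  moreover have "(\<Sum>n. ?f n) = 1"
    using S_fdiff_sums[OF assms(1-3)] by (rule sums_unique[symmetric])
  ultimately show ?thesis
    by (simp only: norm_mult norm_one)
qed

lemma suminf_tendsto_0_if_wnorm_tendsto_0:
  assumes p: "p > 0" and \<alpha>: "\<alpha> < -1" and lim: "(\<lambda>N. wnorm p \<alpha> (S c N)) \<longlonglongrightarrow> 0"
  shows "(\<lambda>N. \<Sum>n. norm (S c N (Suc n)) powr p * real (Suc n) powr \<alpha>) \<longlonglongrightarrow> 0"
proof -
  have "(\<lambda>N. wnorm p \<alpha> (S c N) powr p) \<longlonglongrightarrow> 0"
    using p by (intro tendsto_zero_powrI[OF lim tendsto_const]) (auto simp: wnorm_def)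
  moreover have "wnorm p \<alpha> (S c N) powr p
      = (\<Sum>n. norm (S c N (Suc n)) powr p * real (Suc n) powr \<alpha>)" for N
    using p suminf_nonneg[OF summable_S[OF p \<alpha>, of c N]]
    by (simp add: wnorm_def powr_powr del: of_nat_Suc)
  ultimately show ?thesis by simp
qed

text \<open>
  The weight is split as \<open>n powr (\<alpha> / p)\<close> on \<open>S c N\<close> and its inverse on the functional.  With the
  conjugate exponent \<open>q\<close>, the second factor is \<open>q\<close>-summable exactly when \<open>Re s + 1 + \<alpha> / p > 1 / q\<close>, which
  is the condition \<open>Re s > - (\<alpha> + 1) / p\<close> since \<open>1 / q = 1 - 1 / p\<close>.
\<close>

lemma zeta_nonzero_if_wnorm_tendsto_0:
  assumes p: "p > 1" and \<alpha>: "\<alpha> < -1" and lim: "(\<lambda>N. wnorm p \<alpha> (S c N)) \<longlonglongrightarrow> 0"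
    and s: "s \<noteq> 1" "Re s > - (\<alpha> + 1) / p"
  shows "zeta s \<noteq> 0"
proof
  assume zero: "zeta s = 0"
  define q where "q = p / (p - 1)"
  have pq: "q > 1" "1 / p + 1 / q = 1"
    using p by (auto simp: q_def field_simps)
  have "- (\<alpha> + 1) / p > 0" using p \<alpha> by simp
  with s have s0: "Re s > 0" by simp
  define a where "a N n = norm (S c N (Suc n)) * real (Suc n) powr (\<alpha> / p)" for N n
  define b where "b n = norm (fdiff 1 s (real (Suc n))) * real (Suc n) powr (- \<alpha> / p)" for n
  have a_powr: "a N n powr p = norm (S c N (Suc n)) powr p * real (Suc n) powr \<alpha>" for N n
    using p by (simp add: a_def powr_mult powr_powr del: of_nat_Suc)
  have ab: "a N n * b n = norm (S c N (Suc n)) * norm (fdiff 1 s (real (Suc n)))" for N n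
  proof -
    have "real (Suc n) powr (\<alpha> / p) * real (Suc n) powr (- \<alpha> / p) = 1"
      by (simp add: powr_add[symmetric] del: of_nat_Suc)
    then show ?thesis
      by (simp add: a_def b_def mult_ac del: fdiff.simps of_nat_Suc)
  qed
  have sum_a: "summable (\<lambda>n. a N n powr p)" for N
    unfolding a_powr using p \<alpha> by (intro summable_S) auto
  have sum_b: "summable (\<lambda>n. b n powr q)"
  proof (rule summable_comparison_test')
    have "Re s + 1 + \<alpha> / p > 1 / q"
      using s pq(2) p by (simp add: field_simps)
    then have "(- (Re s + 1) - \<alpha> / p) * q < - 1"
      using pq(1) by (simp add: field_simps)
    then show "summable (\<lambda>n. (norm s + 1) powr q * real (Suc n) powr ((- (Re s + 1) - \<alpha> / p) * q))"
      by (intro summable_mult summable_Suc_powr)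
    fix n
    have "b n \<le> (norm s + 1) * real (Suc n) powr (- (Re s + 1)) * real (Suc n) powr (- \<alpha> / p)"
      unfolding b_def by (intro mult_right_mono norm_fdiff_1_le s0) auto
    also have "\<dots> = (norm s + 1) * real (Suc n) powr (- (Re s + 1) - \<alpha> / p)"
      by (simp add: mult.assoc powr_add[symmetric] del: of_nat_Suc)
    finally have "b n powr q \<le> ((norm s + 1) * real (Suc n) powr (- (Re s + 1) - \<alpha> / p)) powr q"
      using pq(1) by (intro powr_mono2) (auto simp: b_def)
    then show "norm (b n powr q)
        \<le> (norm s + 1) powr q * real (Suc n) powr ((- (Re s + 1) - \<alpha> / p) * q)"
      by (simp add: powr_mult powr_powr del: of_nat_Suc)
  qed
  have nonneg: "a N n \<ge> 0" "b n \<ge> 0" for N n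
    by (auto simp: a_def b_def)
  have "summable (\<lambda>n. a N n * b n)" for N
    using suminf_mult_le_young(1)[OF p pq, of 1 "a N" b] sum_a sum_b nonneg by simp
  then have "1 \<le> (\<Sum>n. a N n * b n)" for N
    unfolding ab by (rule one_le_suminf_S[OF s0 s(1) zero])
  then have "\<not> (\<lambda>N. \<Sum>n. a N n powr p) \<longlonglongrightarrow> 0"
    by (intro not_tendsto_0_if_pairing_ge_1[OF p pq, of a b] nonneg sum_a sum_b)
  then show False
    using suminf_tendsto_0_if_wnorm_tendsto_0[OF _ \<alpha> lim] p by (simp add: a_powr)
qed

text \<open>
  Here the functional is bounded as soon as \<open>n powr (- (Re s + 1)) \<le> n powr \<alpha>\<close>, and no convergence is
  needed, which is why the boundary line is included.
\<close>

lemma zeta_nonzero_if_wnorm_1_tendsto_0: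
  assumes \<alpha>: "\<alpha> < -1" and lim: "(\<lambda>N. wnorm 1 \<alpha> (S c N)) \<longlonglongrightarrow> 0"
    and s: "s \<noteq> 1" "Re s \<ge> - (\<alpha> + 1)"
  shows "zeta s \<noteq> 0"
proof
  assume zero: "zeta s = 0"
  have s0: "Re s > 0" using s \<alpha> by simp
  let ?u = "\<lambda>N n. norm (S c N (Suc n)) powr 1 * real (Suc n) powr \<alpha>"
  have u: "summable (?u N)" for N
    using \<alpha> by (intro summable_S) auto
  have le: "norm (S c N (Suc n)) * norm (fdiff 1 s (real (Suc n))) \<le> (norm s + 1) * ?u N n" for N n
  proof -
    have "norm (fdiff 1 s (real (Suc n))) \<le> (norm s + 1) * real (Suc n) powr (- (Re s + 1))"
      using s0 by (intro norm_fdiff_1_le) auto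
    also have "\<dots> \<le> (norm s + 1) * real (Suc n) powr \<alpha>"
      using s by (intro mult_left_mono powr_mono) auto
    finally have "norm (S c N (Suc n)) * norm (fdiff 1 s (real (Suc n)))
        \<le> norm (S c N (Suc n)) * ((norm s + 1) * real (Suc n) powr \<alpha>)"
      by (rule mult_left_mono) simp
    then show ?thesis
      by (simp add: mult_ac del: fdiff.simps of_nat_Suc)
  qed
  have "1 \<le> (norm s + 1) * (\<Sum>n. ?u N n)" for N
  proof -
    have sum: "summable (\<lambda>n. norm (S c N (Suc n)) * norm (fdiff 1 s (real (Suc n))))"
      by (rule summable_comparison_test'[OF summable_mult[OF u], of 0 _ "norm s + 1" N])
        (use le in \<open>simp del: fdiff.simps of_nat_Suc\<close>)
    have "1 \<le> (\<Sum>n. norm (S c N (Suc n)) * norm (fdiff 1 s (real (Suc n))))"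
      by (rule one_le_suminf_S[OF s0 s(1) zero sum])
    also have "\<dots> \<le> (norm s + 1) * (\<Sum>n. ?u N n)"
      by (rule sums_le[OF le summable_sums[OF sum] sums_mult[OF summable_sums[OF u]]])
    finally show ?thesis .
  qed
  moreover have "(\<lambda>N. (norm s + 1) * (\<Sum>n. ?u N n)) \<longlonglongrightarrow> (norm s + 1) * 0"
    using \<alpha> lim by (intro tendsto_intros suminf_tendsto_0_if_wnorm_tendsto_0) auto
  ultimately have "1 \<le> (norm s + 1) * 0"
    by (intro LIMSEQ_le_const) auto
  then show False by simp
qed

theorem theorem2p1:
  "(\<forall>p \<alpha>::real. 1 < p \<and> p \<le> 2 \<and> \<alpha> \<in> {- 1 - p <.. - 1 - p / 2} \<and>
        (\<exists>c :: nat \<Rightarrow> nat \<Rightarrow> complex. (\<lambda>N. wnorm p \<alpha> (S c N)) \<longlonglongrightarrow> 0) \<longrightarrow>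
        (\<forall>s::complex. s \<noteq> 1 \<and> Re s > - (\<alpha> + 1) / p \<longrightarrow> zeta s \<noteq> 0)) \<and>
   (\<forall>\<alpha>::real. \<alpha> \<in> {- 2 .. - 3 / 2} \<and>
        (\<exists>c :: nat \<Rightarrow> nat \<Rightarrow> complex. (\<lambda>N. wnorm 1 \<alpha> (S c N)) \<longlonglongrightarrow> 0) \<longrightarrow>
        (\<forall>s::complex. s \<noteq> 1 \<and> Re s \<ge> - (\<alpha> + 1) \<longrightarrow> zeta s \<noteq> 0))"
proof (intro conjI allI impI)
  fix p \<alpha> :: real and s :: complex
  assume h: "1 < p \<and> p \<le> 2 \<and> \<alpha> \<in> {- 1 - p <.. - 1 - p / 2} \<and>
      (\<exists>c :: nat \<Rightarrow> nat \<Rightarrow> complex. (\<lambda>N. wnorm p \<alpha> (S c N)) \<longlonglongrightarrow> 0)"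
    and s: "s \<noteq> 1 \<and> Re s > - (\<alpha> + 1) / p"
  then obtain c where "(\<lambda>N. wnorm p \<alpha> (S c N)) \<longlonglongrightarrow> 0" by blast
  with h s show "zeta s \<noteq> 0"
    by (intro zeta_nonzero_if_wnorm_tendsto_0[of p \<alpha> c s]) auto
next
  fix \<alpha> :: real and s :: complex
  assume h: "\<alpha> \<in> {- 2 .. - 3 / 2} \<and>
      (\<exists>c :: nat \<Rightarrow> nat \<Rightarrow> complex. (\<lambda>N. wnorm 1 \<alpha> (S c N)) \<longlonglongrightarrow> 0)"
    and s: "s \<noteq> 1 \<and> Re s \<ge> - (\<alpha> + 1)"
  then obtain c where "(\<lambda>N. wnorm 1 \<alpha> (S c N)) \<longlonglongrightarrow> 0" by blast
  with h s show "zeta s \<noteq> 0"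
    by (intro zeta_nonzero_if_wnorm_1_tendsto_0[of \<alpha> c s]) auto
qed

end
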